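(* For any given value of the random vector $\xi=(y,d_0)$, where $y=(y_i)_{i\in I}$ and $d_0=(d_{0,i})_{i\in I}$, the Wait-and-See problem $$\mathrm{(WS)}\qquad \max_{p,v}\ \sum_{i=1}^n (1-c)\,p_i\min(x_i(v)+y_i,\,d_i(p_i))\quad\text{s.t.}\quad p_i\in[p_{i,\min},p_{i,\max}]\ \ \forall i\in I,\qquad v \text{ solves } F_m(p),$$ is equivalent (in the sense of local and global solutions) to its MPCC (mathematical program with complementarity constraints) reformulation given by $$\mathrm{(MPCC)}\qquad \max_{p,v,\lambda,\gamma}\ \sum_{i=1}^n (1-c)\,p_i\min(x_i(v)+y_i,\,d_i(p_i))$$ subject to $$\begin{cases} p_i\in[p_{i,\min},p_{i,\max}], & \forall i\in I,\\ \sum_{j\neq i}v_{ij}-x_{0,i}\le 0, & \forall i\in I,\\ \sum_{k=1}^m\big(p_i\beta_{i,k}-p_j\beta_{j,k}\big)+\alpha_{ij}-\lambda_{ij}+\gamma_i=0, & \forall i\neq j\in I,\\ \gamma_i\big(\sum_{j\neq i}v_{ij}-x_{0,i}\big)=0, & \forall i\in I,\\ \lambda_{ij}v_{ij}=0, & \forall i\neq j\in I,\\ v\ge 0,\ \gamma\ge 0,\ \lambda\ge 0, \end{cases}$$ where the coefficients $\beta_{i,k}$, for $i\in I$ and $k\in\{1,\dots,m\}$, are given, with $x_i=x_i(v)$ and $d_{i,k}=d_{i,k}(p_i)$, by $$\beta_{i,k}:=\begin{cases}0 & \text{if } d_{i,k}-x_i\le 0,\\ c\rho_k\dfrac{x_i-d_{i,k}}{\bar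 y} & \text{if } 0\le d_{i,k}-x_i\le\bar y,\\ -c\rho_k & \text{if } d_{i,k}-x_i\ge\bar y.\end{cases}$$ Furthermore, the multipliers $\gamma=(\gamma_i)_{i\in I}$ and $\lambda=(\lambda_{ij})_{i\neq j\in I}$ verify $$0\le\gamma_i\le 2m\,p_{\max}\qquad\text{and}\qquad 0\le\lambda_{ij}\le 4m\,p_{\max}+\alpha_{ij},$$ where $p_{\max}=\max_{i\in I}p_{i,\max}$.
   Context: Setting: a ride-hailing company (leader) sets prices and a single follower reallocates unmatched drivers between zones. Data: $I=\{1,\ldots,n\}$ (zones); $c\in(0,1)$ (fraction of the ride price that the driver gets); price bounds $p_{i,\min}<p_{i,\max}$; reallocation costs $\alpha_{ij}$ for $i\ne j$; initial allocation $x_0=(x_{0,1},\dots,x_{0,n})$ of unmatched drivers, with $x_{0,i}>0$ for all $i\in I$; a constant $\bar y>0$ and a demand discount constant $\delta$; demand scenarios $\omega_1,\dots,\omega_m$ with probabilities $\rho_1,\dots,\rho_m$, and nominal demands $d_{0,i}(\omega_k)$ for $i\in I$, $k=1,\dots,m$. In $\xi=(y,d_0)$, $y_i$ is the number of previously matched drivers arriving at zone $i$ and $d_{0,i}$ is the nominal demand in zone $i$. Demand: for the realized nominal demand, $d_i=d_i(p_i)=d_{0,i}\Big(1-\delta\frac{p_i-p_{i,\min}}{p_{i,\max}-p_{i,\min}}\Big)$; for scenario $k$, $d_{i,k}=d_{i,k}(p_i)=d_{0,i}(\omega_k)\Big(1-\delta\frac{p_i-p_{i,\min}}{p_{i,\max}-p_{i,\min}}\Big)$.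 Variables: $p=(p_i)_{i\in I}$ (prices), $v=(v_{ij})_{i\neq j\in I}\in\mathbb{R}^{n(n-1)}$ ($v_{ij}$ is the amount of unmatched drivers moving from zone $i$ to zone $j$) and, for $j\in I$, $x_j(v)=x_{0,j}+\sum_{i\neq j}v_{ij}-\sum_{k\neq j}v_{jk}$. Follower's problem $F_m(p)$ (for fixed $p$): $$\min_v\ c\sum_{i=1}^n\sum_{k=1}^m p_i\,\mathbb{E}_{Y_i\sim U(0,\bar y)}\big[\max(-x_i(v)-Y_i,\,-d_{i,k})\big]\rho_k+\sum_{i\neq j}\alpha_{ij}v_{ij}\quad\text{s.t.}\quad v\ge 0,\ \ \sum_{j\neq i}v_{ij}\le x_{0,i}\ \ \forall i\in I,$$ where $U(0,\bar y)$ is the uniform distribution on $[0,\bar y]$; "$v$ solves $F_m(p)$" means $v$ is a minimizer. Equivalence in the sense of local and global solutions: (global) $(p,v)$ is a global solution of (WS) if and only if there exist multipliers $(\lambda,\gamma)$ such that $(p,v,\lambda,\gamma)$ is a global solution of (MPCC); (local) a point $(p,v)$ feasible for (WS) is a local solution of (WS) if and only if $(p,v,\lambda,\gamma)$ is a local solution of (MPCC) for every $(\lambda,\gamma)$ such that $(p,v,\lambda,\gamma)$ is feasible for (MPCC).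
   Formalization: The stationarity condition is corrected to Σ_k(p_jβ_{j,k} − p_iβ_{i,k}) + α_ij − λ_ij + γ_i = 0 (the printed sign makes the equivalence false), and p_{i,min} ≥ 0 and α_ij ≥ 0 are assumed, without which the multiplier bounds can fail. *)

theory Defs
  imports "HOL-Probability.Probability"
begin

text \<open>
  Zones are the elements of a finite type \<open>'n\<close>, demand scenarios those of a finite type \<open>'m\<close>
  (so \<open>n = CARD('n)\<close> and \<open>m = CARD('m)\<close>).  The field \<open>cost\<close> is only ever used off the diagonal.
\<close>

record ('n, 'm) market =
  share :: real                              \<comment> \<open>\<open>c\<close>, the fraction of the price that goes to the driver\<close>
  price_min :: "'n \<Rightarrow> real"
  price_max :: "'n \<Rightarrow> real"
  cost :: "'n \<Rightarrow> 'n \<Rightarrow> real"                 \<comment> \<open>\<open>\<alpha>\<close>\<close>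
  init :: "'n \<Rightarrow> real"                       \<comment> \<open>\<open>x\<^sub>0\<close>\<close>
  ybar :: real
  discount :: real                           \<comment> \<open>\<open>\<delta>\<close>\<close>
  scen_prob :: "'m \<Rightarrow> real"                  \<comment> \<open>\<open>\<rho>\<close>\<close>
  scen_demand :: "'m \<Rightarrow> 'n \<Rightarrow> real"           \<comment> \<open>\<open>d\<^sub>0\<^sub>,\<^sub>i(\<omega>\<^sub>k)\<close>, scenario first\<close>

text \<open>
  Families indexed by ordered pairs of distinct zones, i.e. \<open>\<real>\<^bsup>n(n-1)\<^esup>\<close>, are square matrices with
  zero diagonal; this is a linear subspace and hence carries the usual topology.
\<close>

definition offdiag :: "(real^'n^'n) set" where
  "offdiag = {v. \<forall>i. v $ i $ i = 0}"

definition demand :: "('n, 'm) market \<Rightarrow> real \<Rightarrow> 'n \<Rightarrow> real \<Rightarrow> real" where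
  "demand D d0 i q =
     d0 * (1 - discount D * ((q - price_min D i) / (price_max D i - price_min D i)))"

definition drivers :: "('n::finite, 'm) market \<Rightarrow> real^'n^'n \<Rightarrow> 'n \<Rightarrow> real" where
  "drivers D v j = init D j + (\<Sum>i | i \<noteq> j. v $ i $ j) - (\<Sum>k | k \<noteq> j. v $ j $ k)"

definition price_feasible :: "('n::finite, 'm) market \<Rightarrow> (real^'n) set" where
  "price_feasible D = {p. \<forall>i. p $ i \<in> {price_min D i..price_max D i}}"

definition follower_feasible :: "('n::finite, 'm) market \<Rightarrow> (real^'n^'n) set" where
  "follower_feasible D =
     {v \<in> offdiag. (\<forall>i j. i \<noteq> j \<longrightarrow> 0 \<le> v $ i $ j) \<and> (\<forall>i. (\<Sum>j | j \<noteq> i. v $ i $ j) \<le> init D i)}"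

definition follower_obj :: "('n::finite, 'm::finite) market \<Rightarrow> real^'n \<Rightarrow> real^'n^'n \<Rightarrow> real" where
  "follower_obj D p v =
     share D * (\<Sum>i\<in>UNIV. \<Sum>k\<in>UNIV.
        p $ i * (\<integral>Y. max (- drivers D v i - Y) (- demand D (scen_demand D k i) i (p $ i))
                   \<partial>uniform_measure lborel {0..ybar D}) * scen_prob D k)
     + (\<Sum>i\<in>UNIV. \<Sum>j | j \<noteq> i. cost D i j * v $ i $ j)"

definition solves_follower :: "('n::finite, 'm::finite) market \<Rightarrow> real^'n \<Rightarrow> real^'n^'n \<Rightarrow> bool" where
  "solves_follower D p v \<longleftrightarrow> is_arg_min (follower_obj D p) (\<lambda>w. w \<in> follower_feasible D) v"

definition leader_obj ::
    "('n::finite, 'm) market \<Rightarrow> real^'n \<Rightarrow> real^'n \<Rightarrow> real^'n \<Rightarrow> real^'n^'n \<Rightarrow> real" where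
  "leader_obj D y d0 p v =
     (\<Sum>i\<in>UNIV. (1 - share D) * p $ i * min (drivers D v i + y $ i) (demand D (d0 $ i) i (p $ i)))"

definition ws_feasible :: "('n::finite, 'm::finite) market \<Rightarrow> ((real^'n) \<times> (real^'n^'n)) set" where
  "ws_feasible D = {(p, v). p \<in> price_feasible D \<and> solves_follower D p v}"

text \<open>The three defining cases overlap only where their values agree.\<close>

definition beta ::
    "('n::finite, 'm) market \<Rightarrow> real^'n \<Rightarrow> real^'n^'n \<Rightarrow> 'n \<Rightarrow> 'm \<Rightarrow> real" where
  "beta D p v i k =
     (let x = drivers D v i; d = demand D (scen_demand D k i) i (p $ i)
      in if d - x \<le> 0 then 0
         else if d - x \<le> ybar D then share D * scen_prob D k * ((x - d) / ybar D)
         else - share D * scen_prob D k)"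

text \<open>
  \<open>beta D p v i k\<close> is the derivative with respect to \<open>x\<^sub>i\<close> of
  \<open>c \<rho>\<^sub>k \<bbbE>[max (- x\<^sub>i - Y\<^sub>i) (- d\<^sub>i\<^sub>,\<^sub>k)]\<close>.  Since \<open>v\<^sub>i\<^sub>j\<close> enters \<open>x\<^sub>j\<close> with coefficient \<open>+1\<close> and \<open>x\<^sub>i\<close>
  with coefficient \<open>-1\<close>, the partial derivative of the follower's objective in \<open>v\<^sub>i\<^sub>j\<close> is
  \<open>(\<Sum>k. p\<^sub>j \<beta>\<^sub>j\<^sub>,\<^sub>k - p\<^sub>i \<beta>\<^sub>i\<^sub>,\<^sub>k) + \<alpha>\<^sub>i\<^sub>j\<close>.  The source prints this difference with the opposite sign,
  for which the equivalence with the bilevel problem fails already for two zones and one scenario.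
\<close>

definition mpcc_feasible ::
    "('n::finite, 'm::finite) market \<Rightarrow> ((real^'n) \<times> (real^'n^'n) \<times> (real^'n^'n) \<times> (real^'n)) set" where
  "mpcc_feasible D =
     {(p, v, l, g). v \<in> offdiag \<and> l \<in> offdiag \<and>
        (\<forall>i. p $ i \<in> {price_min D i..price_max D i}) \<and>
        (\<forall>i. (\<Sum>j | j \<noteq> i. v $ i $ j) - init D i \<le> 0) \<and>
        (\<forall>i j. i \<noteq> j \<longrightarrow>
           (\<Sum>k\<in>UNIV. p $ j * beta D p v j k - p $ i * beta D p v i k)
             + cost D i j - l $ i $ j + g $ i = 0) \<and>
        (\<forall>i. g $ i * ((\<Sum>j | j \<noteq> i. v $ i $ j) - init D i) = 0) \<and>
        (\<forall>i j. i \<noteq> j \<longrightarrow> l $ i $ j * v $ i $ j = 0) \<and>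
        (\<forall>i j. i \<noteq> j \<longrightarrow> 0 \<le> v $ i $ j) \<and> (\<forall>i. 0 \<le> g $ i) \<and> (\<forall>i j. i \<noteq> j \<longrightarrow> 0 \<le> l $ i $ j)}"

definition global_max_on :: "('a \<Rightarrow> real) \<Rightarrow> 'a set \<Rightarrow> 'a \<Rightarrow> bool" where
  "global_max_on f S z \<longleftrightarrow> is_arg_max f (\<lambda>w. w \<in> S) z"

definition local_max_on :: "('a::topological_space \<Rightarrow> real) \<Rightarrow> 'a set \<Rightarrow> 'a \<Rightarrow> bool" where
  "local_max_on f S z \<longleftrightarrow> (\<exists>U. open U \<and> z \<in> U \<and> is_arg_max f (\<lambda>w. w \<in> S \<inter> U) z)"

definition ws_global :: "('n::finite, 'm::finite) market \<Rightarrow> real^'n \<Rightarrow> real^'n \<Rightarrow>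
    (real^'n) \<times> (real^'n^'n) \<Rightarrow> bool" where
  "ws_global D y d0 = global_max_on (\<lambda>(p, v). leader_obj D y d0 p v) (ws_feasible D)"

definition ws_local :: "('n::finite, 'm::finite) market \<Rightarrow> real^'n \<Rightarrow> real^'n \<Rightarrow>
    (real^'n) \<times> (real^'n^'n) \<Rightarrow> bool" where
  "ws_local D y d0 = local_max_on (\<lambda>(p, v). leader_obj D y d0 p v) (ws_feasible D)"

definition mpcc_global :: "('n::finite, 'm::finite) market \<Rightarrow> real^'n \<Rightarrow> real^'n \<Rightarrow>
    (real^'n) \<times> (real^'n^'n) \<times> (real^'n^'n) \<times> (real^'n) \<Rightarrow> bool" where
  "mpcc_global D y d0 = global_max_on (\<lambda>(p, v, l, g). leader_obj D y d0 p v) (mpcc_feasible D)"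

definition mpcc_local :: "('n::finite, 'm::finite) market \<Rightarrow> real^'n \<Rightarrow> real^'n \<Rightarrow>
    (real^'n) \<times> (real^'n^'n) \<times> (real^'n^'n) \<times> (real^'n) \<Rightarrow> bool" where
  "mpcc_local D y d0 = local_max_on (\<lambda>(p, v, l, g). leader_obj D y d0 p v) (mpcc_feasible D)"

end

theory Submission
  imports Defs
begin

text \<open>
  The feasible set of the MPCC is the graph of a continuous map over the feasible set of the
  Wait-and-See problem, and both problems have the same objective; so their global and their local
  solutions correspond.  Two facts give the graph description.

  First, the multipliers are determined by \<open>(p, v)\<close>.  Write \<open>m\<^sub>i\<^sub>j\<close> for the partial derivative of the
  follower's objective with respect to \<open>v\<^sub>i\<^sub>j\<close>.  Stationarity reads \<open>\<lambda>\<^sub>i\<^sub>j = m\<^sub>i\<^sub>j + \<gamma>\<^sub>i\<close>, so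
  \<open>\<gamma>\<^sub>i \<ge> - m\<^sub>i\<^sub>j\<close> for all \<open>j\<close>.  If \<open>\<gamma>\<^sub>i > 0\<close>, then all of the \<open>x\<^sub>0\<^sub>,\<^sub>i > 0\<close> drivers of zone \<open>i\<close> leave, hence
  \<open>v\<^sub>i\<^sub>j > 0\<close> and \<open>\<gamma>\<^sub>i = - m\<^sub>i\<^sub>j\<close> for some \<open>j\<close>.  Therefore \<open>\<gamma>\<^sub>i = max (0, max\<^sub>j (- m\<^sub>i\<^sub>j))\<close>
  (lemma \<open>kkt_multipliers_unique\<close>).  This formula is continuous in \<open>(p, v)\<close> because \<open>\<beta>\<close> is.
  With \<open>P\<close> the largest admissible price, \<open>m\<^sub>i\<^sub>j\<close> lies between \<open>- P\<close> and \<open>P + \<alpha>\<^sub>i\<^sub>j\<close>, so the formula also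
  yields the bounds on the multipliers (lemma \<open>dual_bounds\<close>).

  Second, for these multipliers the KKT system holds exactly at the minimizers of the follower's
  problem (lemmas \<open>kkt_sufficient\<close> and \<open>kkt_necessary\<close>).  Prices are nonnegative, so the objective is
  convex; the only analytic input is its subgradient inequality with slopes \<open>m\<^sub>i\<^sub>j\<close> (lemma
  \<open>follower_obj_subgradient\<close>), which is obtained by integrating a pointwise inequality over \<open>Y\<close>.
  Sufficiency is immediate from it.  For necessity, the subgradient inequality at points
  \<open>v + t (w - v)\<close> with \<open>t \<rightarrow> 0\<close> and the continuity of \<open>m\<close> show that \<open>v\<close> minimizes the linear
  functional \<open>w \<mapsto> \<Sum> m\<^sub>i\<^sub>j w\<^sub>i\<^sub>j\<close>.  The feasible set is a product over \<open>i\<close> of the sets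
  \<open>{w \<ge> 0. \<Sum>\<^sub>j w\<^sub>i\<^sub>j \<le> x\<^sub>0\<^sub>,\<^sub>i}\<close>, on which the minimum is attained at a vertex; comparing \<open>v\<close> with
  that vertex gives complementary slackness.
\<close>

section \<open>The subgradient inequality for the follower's objective\<close>

text \<open>
  The clamped quotient is the probability that \<open>Y\<^sub>i < d\<^sub>i\<^sub>,\<^sub>k - x\<^sub>i\<close>; this form makes continuity and the
  range of \<open>beta\<close> evident.
\<close>

lemma beta_eq_clamp:
  assumes "0 < ybar D"
  shows "beta D p v i k = - (share D * scen_prob D k *
    max 0 (min 1 ((demand D (scen_demand D k i) i (p $ i) - drivers D v i) / ybar D)))"
proof -
  define z where "z = demand D (scen_demand D k i) i (p $ i) - drivers D v i"
  have "(drivers D v i - demand D (scen_demand D k i) i (p $ i)) / ybar D = - (z / ybar D)"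
    unfolding z_def by (metis minus_diff_eq minus_divide_left)
  then have "beta D p v i k = - (share D * scen_prob D k *
      (if z \<le> 0 then 0 else if z \<le> ybar D then z / ybar D else 1))"
    unfolding beta_def Let_def z_def by simp
  also have "(if z \<le> 0 then 0 else if z \<le> ybar D then z / ybar D else 1) = max 0 (min 1 (z / ybar D))"
    using assms by (auto simp: max_def min_def divide_le_0_iff zero_le_divide_iff)
  finally show ?thesis unfolding z_def .
qed

lemma uniform_measure_lessThan:
  fixes b z :: real
  assumes "0 < b"
  shows "measure (uniform_measure lborel {0..b}) {..<z} = max 0 (min 1 (z / b))"
proof -
  have "measure (uniform_measure lborel {0..b}) {..<z} = measure lborel ({0..b} \<inter> {..<z}) / b"
    using assms by (subst measure_uniform_measure) auto
  also have "measure lborel ({0..b} \<inter> {..<z}) = max 0 (min b z)"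
  proof (cases "z \<le> b")
    case True
    then have "{0..b} \<inter> {..<z} = {0..<z}" by auto
    with True assms show ?thesis by (cases "0 \<le> z") auto
  next
    case False
    then have "{0..b} \<inter> {..<z} = {0..b}" by auto
    with False assms show ?thesis by auto
  qed
  finally show ?thesis using assms by (auto simp: max_def min_def field_simps)
qed

text \<open>
  Pointwise in \<open>Y\<close>, the function \<open>x \<mapsto> max (- x - Y) (- d)\<close> is convex with slope \<open>-1\<close> where
  \<open>Y < d - x\<close> and \<open>0\<close> elsewhere; integration turns the slope into a probability.
\<close>

lemma uniform_max_subgradient:
  fixes b d x x' :: real
  assumes "0 < b"
  defines "M \<equiv> uniform_measure lborel {0..b}"
  shows "(\<integral>Y. max (- x - Y) (- d) \<partial>M) - max 0 (min 1 ((d - x) / b)) * (x' - x)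
         \<le> (\<integral>Y. max (- x' - Y) (- d) \<partial>M)"
proof -
  interpret prob_space M unfolding M_def
    using assms by (intro prob_space_uniform_measure) auto
  have int: "integrable M (\<lambda>Y. max (- u - Y) (- d))" for u
  proof (rule integrable_const_bound[where B = "\<bar>u\<bar> + b + \<bar>d\<bar>"])
    show "AE Y in M. norm (max (- u - Y) (- d)) \<le> \<bar>u\<bar> + b + \<bar>d\<bar>"
      unfolding M_def by (rule AE_uniform_measureI) (auto simp: max_def)
  qed (simp add: M_def)
  have ind: "integrable M (indicator {..<d - x} :: real \<Rightarrow> real)"
    by (rule integrable_const_bound[where B = 1]) (auto simp: M_def indicator_def)
  have "(\<integral>Y. max (- x - Y) (- d) \<partial>M) - max 0 (min 1 ((d - x) / b)) * (x' - x)
      = (\<integral>Y. max (- x - Y) (- d) - indicator {..<d - x} Y * (x' - x) \<partial>M)"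
    using int ind uniform_measure_lessThan[OF assms(1), of "d - x"]
    by (subst Bochner_Integration.integral_diff) (auto simp: M_def)
  also have "\<dots> \<le> (\<integral>Y. max (- x' - Y) (- d) \<partial>M)"
  proof (rule integral_mono)
    show "integrable M (\<lambda>Y. max (- x - Y) (- d) - indicator {..<d - x} Y * (x' - x))"
      by (intro Bochner_Integration.integrable_diff int integrable_mult_left ind)
  qed (use int in \<open>auto simp: max_def indicator_def\<close>)
  finally show ?thesis .
qed

text \<open>The diagonal entries cancel, so they may be included in both sums.\<close>

lemma drivers_eq:
  "drivers D v j = init D j + (\<Sum>i\<in>UNIV. v $ i $ j) - (\<Sum>i\<in>UNIV. v $ j $ i)"
proof -
  have "(\<Sum>i\<in>UNIV. f i) = f j + (\<Sum>i | i \<noteq> j. f i)" for f :: "'a \<Rightarrow> real"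
    by (subst sum.remove[of _ j]) (auto intro!: sum.cong)
  then show ?thesis unfolding drivers_def by simp
qed

text \<open>
  The partial derivative of the follower's objective with respect to \<open>v\<^sub>i\<^sub>j\<close>, given directly by its
  formula; it is meant for \<open>i \<noteq> j\<close> only.  That it is a subgradient is the next lemma;
  differentiability is never used.
\<close>

definition marginal ::
    "('n::finite, 'm::finite) market \<Rightarrow> real^'n \<Rightarrow> real^'n^'n \<Rightarrow> 'n \<Rightarrow> 'n \<Rightarrow> real" where
  "marginal D p v i j =
     (\<Sum>k\<in>UNIV. p $ j * beta D p v j k - p $ i * beta D p v i k) + cost D i j"

lemma follower_obj_subgradient:
  fixes D :: "('n::finite, 'm::finite) market"
  assumes "0 < share D" "0 < ybar D" "\<And>k. 0 \<le> scen_prob D k" "\<And>i. 0 \<le> p $ i"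
  shows "follower_obj D p v
           + (\<Sum>i\<in>UNIV. \<Sum>j | j \<noteq> i. marginal D p v i j * (w $ i $ j - v $ i $ j))
         \<le> follower_obj D p w"
proof -
  define B where "B i = (\<Sum>k\<in>UNIV. p $ i * beta D p v i k)" for i
  define u where "u i j = w $ i $ j - v $ i $ j" for i j
  define h where "h x i k = (\<integral>Y. max (- x - Y) (- demand D (scen_demand D k i) i (p $ i))
                   \<partial>uniform_measure lborel {0..ybar D})" for x i k
  have term_le: "share D * (p $ i * h (drivers D v i) i k * scen_prob D k)
        + p $ i * beta D p v i k * (drivers D w i - drivers D v i)
      \<le> share D * (p $ i * h (drivers D w i) i k * scen_prob D k)" for i k
  proof -
    define q where "q = max 0 (min 1 ((demand D (scen_demand D k i) i (p $ i) - drivers D v i) / ybar D))"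
    have "h (drivers D v i) i k - q * (drivers D w i - drivers D v i) \<le> h (drivers D w i) i k"
      unfolding h_def q_def by (rule uniform_max_subgradient) (use assms in auto)
    then have "(share D * scen_prob D k * p $ i) * (h (drivers D v i) i k - q * (drivers D w i - drivers D v i))
        \<le> (share D * scen_prob D k * p $ i) * h (drivers D w i) i k"
      by (intro mult_left_mono) (use assms in auto)
    then show ?thesis
      using beta_eq_clamp[OF assms(2), of p v i k] unfolding q_def by (simp add: algebra_simps)
  qed
  \<comment> \<open>The slopes in the variables \<open>x\<^sub>i\<close> are now rearranged into slopes in the flows \<open>v\<^sub>i\<^sub>j\<close>.\<close>
  have drv: "drivers D w i - drivers D v i = (\<Sum>j\<in>UNIV. u j i) - (\<Sum>j\<in>UNIV. u i j)" for i
    unfolding drivers_eq u_def by (simp add: sum_subtractf)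
  have "(\<Sum>i\<in>UNIV. B i * (drivers D w i - drivers D v i))
      = (\<Sum>i\<in>UNIV. \<Sum>j\<in>UNIV. B i * u j i) - (\<Sum>i\<in>UNIV. \<Sum>j\<in>UNIV. B i * u i j)"
    unfolding drv by (simp add: right_diff_distrib sum_subtractf sum_distrib_left)
  also have "(\<Sum>i\<in>UNIV. \<Sum>j\<in>UNIV. B i * u j i) = (\<Sum>i\<in>UNIV. \<Sum>j\<in>UNIV. B j * u i j)"
    by (rule sum.swap)
  also have "\<dots> - (\<Sum>i\<in>UNIV. \<Sum>j\<in>UNIV. B i * u i j) = (\<Sum>i\<in>UNIV. \<Sum>j\<in>UNIV. (B j - B i) * u i j)"
    by (simp add: left_diff_distrib sum_subtractf)
  also have "\<dots> = (\<Sum>i\<in>UNIV. \<Sum>j | j \<noteq> i. (B j - B i) * u i j)"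
    by (intro sum.cong sum.mono_neutral_right) auto
  finally have swap: "(\<Sum>i\<in>UNIV. B i * (drivers D w i - drivers D v i))
      = (\<Sum>i\<in>UNIV. \<Sum>j | j \<noteq> i. (B j - B i) * u i j)" .
  have "(\<Sum>i\<in>UNIV. \<Sum>j | j \<noteq> i. marginal D p v i j * u i j)
      = (\<Sum>i\<in>UNIV. \<Sum>j | j \<noteq> i. (B j - B i) * u i j) + (\<Sum>i\<in>UNIV. \<Sum>j | j \<noteq> i. cost D i j * u i j)"
    unfolding marginal_def B_def by (simp add: sum_subtractf distrib_right sum.distrib)
  also have "\<dots> = (\<Sum>i\<in>UNIV. \<Sum>k\<in>UNIV. p $ i * beta D p v i k * (drivers D w i - drivers D v i))
      + ((\<Sum>i\<in>UNIV. \<Sum>j | j \<noteq> i. cost D i j * w $ i $ j) - (\<Sum>i\<in>UNIV. \<Sum>j | j \<noteq> i. cost D i j * v $ i $ j))"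
    unfolding swap[symmetric] unfolding B_def u_def
    by (simp add: sum_distrib_right right_diff_distrib[of "cost D _ _"] sum_subtractf)
  finally have lin: "(\<Sum>i\<in>UNIV. \<Sum>j | j \<noteq> i. marginal D p v i j * (w $ i $ j - v $ i $ j)) = \<dots>"
    unfolding u_def .
  have "(\<Sum>i\<in>UNIV. \<Sum>k\<in>UNIV. share D * (p $ i * h (drivers D v i) i k * scen_prob D k)
        + p $ i * beta D p v i k * (drivers D w i - drivers D v i))
     \<le> (\<Sum>i\<in>UNIV. \<Sum>k\<in>UNIV. share D * (p $ i * h (drivers D w i) i k * scen_prob D k))"
    by (intro sum_mono term_le)
  then show ?thesis
    unfolding follower_obj_def lin by (simp add: h_def sum.distrib sum_distrib_left)
qed

section \<open>The multipliers as continuous functions of prices and flows\<close>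

lemma continuous_on_Max_image:
  fixes F :: "'a \<Rightarrow> 'b::topological_space \<Rightarrow> 'c::linorder_topology"
  assumes "finite J" "J \<noteq> {}" "\<And>j. j \<in> J \<Longrightarrow> continuous_on S (F j)"
  shows "continuous_on S (\<lambda>x. Max ((\<lambda>j. F j x) ` J))"
  using assms
proof (induction J rule: finite_ne_induct)
  case (insert a J)
  then have "(\<lambda>x. Max ((\<lambda>j. F j x) ` insert a J)) = (\<lambda>x. max (F a x) (Max ((\<lambda>j. F j x) ` J)))"
    by simp
  then show ?case using insert by (auto intro!: continuous_on_max)
qed auto

lemma continuous_on_marginal:
  fixes D :: "('n::finite, 'm::finite) market"
  assumes "0 < ybar D"
  shows "continuous_on UNIV (\<lambda>z. marginal D (fst z) (snd z) i j)"
  unfolding marginal_def beta_eq_clamp[OF assms] demand_def drivers_def divide_inverse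
  by (intro continuous_intros)

text \<open>
  The multiplier \<open>\<gamma>\<close> of the constraints \<open>\<Sum>\<^sub>j v\<^sub>i\<^sub>j \<le> x\<^sub>0\<^sub>,\<^sub>i\<close>: the smallest nonnegative number with
  \<open>m\<^sub>i\<^sub>j + \<gamma>\<^sub>i \<ge> 0\<close> for all \<open>j \<noteq> i\<close>, where \<open>m\<^sub>i\<^sub>j\<close> is the marginal cost.  The diagonal entry \<open>0\<close> makes
  the maximum nonnegative.
\<close>

definition row_dual ::
    "('n::finite, 'm::finite) market \<Rightarrow> real^'n \<Rightarrow> real^'n^'n \<Rightarrow> real^'n" where
  "row_dual D p v = (\<chi> i. Max ((\<lambda>j. if j = i then 0 else - marginal D p v i j) ` UNIV))"

text \<open>
  The multiplier \<open>\<lambda>\<close> of the constraints \<open>v \<ge> 0\<close>, obtained from \<open>\<gamma>\<close> by stationarity, with zero diagonal.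
\<close>

definition sign_dual ::
    "('n::finite, 'm::finite) market \<Rightarrow> real^'n \<Rightarrow> real^'n^'n \<Rightarrow> real^'n^'n" where
  "sign_dual D p v = (\<chi> i j. if j = i then 0 else marginal D p v i j + row_dual D p v $ i)"

lemma continuous_on_duals:
  fixes D :: "('n::finite, 'm::finite) market"
  assumes "0 < ybar D"
  shows "continuous_on UNIV (\<lambda>z. row_dual D (fst z) (snd z))"
    and "continuous_on UNIV (\<lambda>z. sign_dual D (fst z) (snd z))"
proof -
  show row: "continuous_on UNIV (\<lambda>z. row_dual D (fst z) (snd z))"
    unfolding row_dual_def
  proof (intro continuous_on_vec_lambda continuous_on_Max_image)
    show "continuous_on UNIV (\<lambda>z. if j = i then 0 else - marginal D (fst z) (snd z) i j)" for i j
      using continuous_on_marginal[OF assms] by (cases "j = i") (auto intro!: continuous_on_minus)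
  qed auto
  have "continuous_on UNIV (\<lambda>z. if j = i then 0
      else marginal D (fst z) (snd z) i j + row_dual D (fst z) (snd z) $ i)" for i j
    using continuous_on_marginal[OF assms] continuous_on_component[OF row]
    by (cases "j = i") (auto intro!: continuous_on_add)
  then show "continuous_on UNIV (\<lambda>z. sign_dual D (fst z) (snd z))"
    unfolding sign_dual_def by (intro continuous_on_vec_lambda)
qed

lemma row_dual_nonneg: "0 \<le> row_dual D p v $ i"
proof -
  let ?F = "\<lambda>j. if j = i then 0 else - marginal D p v i j"
  have "?F i \<le> Max (range ?F)" by (intro Max_ge) auto
  then show ?thesis by (simp add: row_dual_def)
qed

lemma row_dual_cases:
  obtains "row_dual D p v $ i = 0"
  | j where "j \<noteq> i" "row_dual D p v $ i = - marginal D p v i j" "0 < row_dual D p v $ i"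
proof -
  let ?F = "\<lambda>j. if j = i then 0 else - marginal D p v i j"
  have "Max (range ?F) \<in> range ?F" by (intro Max_in) auto
  then obtain j where "Max (range ?F) = ?F j" by (rule imageE)
  then have "row_dual D p v $ i = ?F j"
    unfolding row_dual_def vec_lambda_beta .
  then show ?thesis
    using that(1) that(2)[of j] row_dual_nonneg[of D p v i] by (cases "j = i \<or> ?F j \<le> 0") auto
qed

lemma sign_dual_nonneg: "0 \<le> sign_dual D p v $ i $ j"
proof (cases "j = i")
  case False
  let ?F = "\<lambda>j. if j = i then 0 else - marginal D p v i j"
  have "?F j \<le> Max (range ?F)" by (intro Max_ge) auto
  then have "- marginal D p v i j \<le> row_dual D p v $ i" using False by (simp add: row_dual_def)
  then show ?thesis using False by (simp add: sign_dual_def)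
qed (simp add: sign_dual_def)

section \<open>The KKT system characterizes the follower's minimizers\<close>

lemma convex_follower_feasible: "convex (follower_feasible D)"
proof (rule convexI)
  fix v w :: "real^'a^'a" and s t :: real
  assume v: "v \<in> follower_feasible D" and w: "w \<in> follower_feasible D"
    and st: "0 \<le> s" "0 \<le> t" "s + t = 1"
  have "(\<Sum>j | j \<noteq> i. (s *\<^sub>R v + t *\<^sub>R w) $ i $ j) \<le> init D i" for i
  proof -
    have "(\<Sum>j | j \<noteq> i. (s *\<^sub>R v + t *\<^sub>R w) $ i $ j)
        = s * (\<Sum>j | j \<noteq> i. v $ i $ j) + t * (\<Sum>j | j \<noteq> i. w $ i $ j)"
      by (simp add: sum.distrib sum_distrib_left)
    also have "\<dots> \<le> init D i"
      using v w st by (intro convex_bound_le) (auto simp: follower_feasible_def)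
    finally show ?thesis .
  qed
  then show "s *\<^sub>R v + t *\<^sub>R w \<in> follower_feasible D"
    using v w st by (auto simp: follower_feasible_def offdiag_def)
qed

text \<open>
  Minimality of \<open>v\<close> and the subgradient inequality at \<open>v + t (w - v)\<close> give the claim with the slopes
  taken at that point; continuity of the slopes permits the limit \<open>t \<rightarrow> 0\<close>.
\<close>

lemma follower_first_order:
  fixes D :: "('n::finite, 'm::finite) market"
  assumes "0 < share D" "0 < ybar D" "\<And>k. 0 \<le> scen_prob D k" "\<And>i. 0 \<le> p $ i"
    and v: "solves_follower D p v" and w: "w \<in> follower_feasible D"
  shows "0 \<le> (\<Sum>i\<in>UNIV. \<Sum>j | j \<noteq> i. marginal D p v i j * (w $ i $ j - v $ i $ j))"
proof -
  define vt where "vt t = v + t *\<^sub>R (w - v)" for t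
  define G where "G t = (\<Sum>i\<in>UNIV. \<Sum>j | j \<noteq> i. marginal D p (vt t) i j * (w $ i $ j - v $ i $ j))" for t
  have vf: "v \<in> follower_feasible D"
    and min: "\<And>u. u \<in> follower_feasible D \<Longrightarrow> follower_obj D p v \<le> follower_obj D p u"
    using v unfolding solves_follower_def is_arg_min_def by (auto simp: not_less)
  have "0 \<le> G t" if t: "0 < t" "t \<le> 1" for t
  proof -
    have "vt t = (1 - t) *\<^sub>R v + t *\<^sub>R w" by (simp add: vt_def algebra_simps)
    then have "vt t \<in> follower_feasible D"
      using convexD[OF convex_follower_feasible vf w, of "1 - t" t] t by simp
    then have "follower_obj D p v \<le> follower_obj D p (vt t)" by (rule min)
    moreover have "follower_obj D p (vt t)
        + (\<Sum>i\<in>UNIV. \<Sum>j | j \<noteq> i. marginal D p (vt t) i j * (v $ i $ j - vt t $ i $ j)) \<le> follower_obj D p v"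
      by (rule follower_obj_subgradient) (use assms in auto)
    moreover have "(\<Sum>i\<in>UNIV. \<Sum>j | j \<noteq> i. marginal D p (vt t) i j * (v $ i $ j - vt t $ i $ j)) = - t * G t"
      unfolding G_def sum_distrib_left by (intro sum.cong refl) (simp add: vt_def algebra_simps)
    ultimately have "0 \<le> t * G t" by simp
    then show ?thesis using t by (simp add: zero_le_mult_iff)
  qed
  then have "eventually (\<lambda>t. 0 \<le> G t) (at_right 0)"
    by (intro eventually_at_rightI[of 0 1]) auto
  moreover have "continuous_on UNIV G"
    unfolding G_def
    by (intro continuous_intros continuous_on_compose2[OF continuous_on_marginal[OF assms(2)],
          where f = "\<lambda>t. (p, vt t)", unfolded fst_conv snd_conv])
       (auto simp: vt_def intro!: continuous_intros)
  then have "(G \<longlongrightarrow> G 0) (at_right 0)"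
    by (auto simp: continuous_on_def intro: tendsto_within_subset)
  ultimately have "0 \<le> G 0" by (intro tendsto_lowerbound) auto
  then show ?thesis by (simp add: G_def vt_def)
qed

text \<open>The constraints of the MPCC, grouped by feasibility, stationarity, complementarity and sign.\<close>

lemma mpcc_feasible_iff:
  "(p, v, l, g) \<in> mpcc_feasible D \<longleftrightarrow>
     p \<in> price_feasible D \<and> v \<in> follower_feasible D \<and> l \<in> offdiag \<and>
     (\<forall>i j. i \<noteq> j \<longrightarrow> l $ i $ j = marginal D p v i j + g $ i) \<and>
     (\<forall>i. g $ i * ((\<Sum>j | j \<noteq> i. v $ i $ j) - init D i) = 0) \<and>
     (\<forall>i j. i \<noteq> j \<longrightarrow> l $ i $ j * v $ i $ j = 0) \<and>
     (\<forall>i. 0 \<le> g $ i) \<and> (\<forall>i j. i \<noteq> j \<longrightarrow> 0 \<le> l $ i $ j)"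
proof -
  have "a - b + c = 0 \<longleftrightarrow> b = a + c" "a - b \<le> 0 \<longleftrightarrow> a \<le> b" for a b c :: real
    by auto
  then show ?thesis
    unfolding mpcc_feasible_def price_feasible_def follower_feasible_def marginal_def
      mem_Collect_eq prod.case
    by (simp only:) (intro iffI; elim conjE; intro conjI; assumption)
qed

lemma kkt_sufficient:
  fixes D :: "('n::finite, 'm::finite) market"
  assumes "0 < share D" "0 < ybar D" "\<And>k. 0 \<le> scen_prob D k" "\<And>i. 0 \<le> p $ i"
    and kkt: "(p, v, l, g) \<in> mpcc_feasible D"
  shows "solves_follower D p v"
proof -
  note k = kkt[unfolded mpcc_feasible_iff]
  have "follower_obj D p v \<le> follower_obj D p w" if w: "w \<in> follower_feasible D" for w
  proof -
    have "0 \<le> (\<Sum>j | j \<noteq> i. marginal D p v i j * (w $ i $ j - v $ i $ j))" for i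
    proof -
      have "marginal D p v i j * (w $ i $ j - v $ i $ j)
          = l $ i $ j * w $ i $ j - g $ i * w $ i $ j + g $ i * v $ i $ j" if "j \<noteq> i" for j
      proof -
        have "marginal D p v i j = l $ i $ j - g $ i" "l $ i $ j * v $ i $ j = 0"
          using k that by (metis add_diff_cancel_right', metis)
        moreover from this(2) have "l $ i $ j * (w $ i $ j - v $ i $ j) = l $ i $ j * w $ i $ j"
          by (simp only: right_diff_distrib)
        ultimately show ?thesis by (simp only: left_diff_distrib right_diff_distrib)
      qed
      then have "(\<Sum>j | j \<noteq> i. marginal D p v i j * (w $ i $ j - v $ i $ j))
          = (\<Sum>j | j \<noteq> i. l $ i $ j * w $ i $ j)
            - g $ i * (\<Sum>j | j \<noteq> i. w $ i $ j) + g $ i * (\<Sum>j | j \<noteq> i. v $ i $ j)"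
        by (simp add: sum.distrib sum_subtractf sum_distrib_left)
      also have "g $ i * (\<Sum>j | j \<noteq> i. v $ i $ j) = g $ i * init D i"
        using k by (auto simp: algebra_simps)
      finally have "(\<Sum>j | j \<noteq> i. marginal D p v i j * (w $ i $ j - v $ i $ j))
          = (\<Sum>j | j \<noteq> i. l $ i $ j * w $ i $ j) + g $ i * (init D i - (\<Sum>j | j \<noteq> i. w $ i $ j))"
        by (simp add: algebra_simps)
      also have "\<dots> \<ge> 0"
        using k w by (intro add_nonneg_nonneg sum_nonneg mult_nonneg_nonneg)
          (auto simp: follower_feasible_def)
      finally show ?thesis .
    qed
    then have "0 \<le> (\<Sum>i\<in>UNIV. \<Sum>j | j \<noteq> i. marginal D p v i j * (w $ i $ j - v $ i $ j))"
      by (rule sum_nonneg)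
    with follower_obj_subgradient[OF assms(1-4), of v w] show ?thesis by linarith
  qed
  with k show ?thesis
    unfolding solves_follower_def is_arg_min_def by (auto simp: not_less)
qed

lemma kkt_necessary:
  fixes D :: "('n::finite, 'm::finite) market"
  assumes "0 < share D" "0 < ybar D" "\<And>k. 0 \<le> scen_prob D k" "\<And>i. 0 < init D i"
    and p: "p \<in> price_feasible D" "\<And>i. 0 \<le> p $ i"
    and v: "solves_follower D p v"
  shows "(p, v, sign_dual D p v, row_dual D p v) \<in> mpcc_feasible D"
proof -
  let ?g = "row_dual D p v" and ?l = "sign_dual D p v"
  have "\<exists>k. ?g $ i = 0 \<or> (k \<noteq> i \<and> ?g $ i = - marginal D p v i k \<and> 0 < ?g $ i)" for i
    by (rule row_dual_cases[of D p v i]) auto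
  then obtain k where k: "\<And>i. ?g $ i = 0 \<or> (k i \<noteq> i \<and> ?g $ i = - marginal D p v i (k i) \<and> 0 < ?g $ i)"
    by metis
  \<comment> \<open>A vertex minimizing the linearized objective: in each row with a negative slope, all drivers
      take the connection of least slope; in every other row nobody moves.\<close>
  define w :: "real^'n^'n" where "w = (\<chi> i j. if 0 < ?g $ i \<and> j = k i then init D i else 0)"
  have vf: "v \<in> follower_feasible D"
    using v unfolding solves_follower_def is_arg_min_def by auto
  have wrow: "(\<Sum>j | j \<noteq> i. f j * w $ i $ j) = (if 0 < ?g $ i then f (k i) * init D i else 0)"
    for f and i
  proof (cases "0 < ?g $ i")
    case True
    then have "k i \<noteq> i" using k[of i] by auto
    have "(\<Sum>j | j \<noteq> i. f j * w $ i $ j) = (\<Sum>j | j \<noteq> i. if j = k i then f j * init D i else 0)"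
      using True by (intro sum.cong) (auto simp: w_def)
    also have "\<dots> = f (k i) * init D i"
      using \<open>k i \<noteq> i\<close> by simp
    finally show ?thesis using True by simp
  qed (simp add: w_def)
  have "w \<in> follower_feasible D"
  proof -
    have "w $ i $ i = 0" "0 \<le> w $ i $ j" for i j
      using k[of i] assms(4)[of i] by (auto simp: w_def)
    moreover have "(\<Sum>j | j \<noteq> i. w $ i $ j) \<le> init D i" for i
      using wrow[of "\<lambda>_. 1" i] assms(4)[of i] by auto
    ultimately show ?thesis by (auto simp: follower_feasible_def offdiag_def)
  qed
  have row: "(\<Sum>j | j \<noteq> i. marginal D p v i j * (w $ i $ j - v $ i $ j))
      = - (?g $ i * (init D i - (\<Sum>j | j \<noteq> i. v $ i $ j))
           + (\<Sum>j | j \<noteq> i. ?l $ i $ j * v $ i $ j))" for i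
  proof -
    have "(\<Sum>j | j \<noteq> i. marginal D p v i j * v $ i $ j)
        = (\<Sum>j | j \<noteq> i. ?l $ i $ j * v $ i $ j - ?g $ i * v $ i $ j)"
      by (intro sum.cong) (auto simp: sign_dual_def algebra_simps)
    moreover have "(\<Sum>j | j \<noteq> i. marginal D p v i j * w $ i $ j) = - ?g $ i * init D i"
      using k[of i] wrow[of "marginal D p v i" i] by auto
    ultimately show ?thesis
      by (simp add: right_diff_distrib sum_subtractf sum_distrib_left)
  qed
  \<comment> \<open>Passing from \<open>v\<close> to \<open>w\<close>, row \<open>i\<close> changes the linearized objective by minus the sum \<open>s i\<close> of its
      complementarity products.  All of these are nonnegative, so all must vanish.\<close>
  define s where "s i = ?g $ i * (init D i - (\<Sum>j | j \<noteq> i. v $ i $ j))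
           + (\<Sum>j | j \<noteq> i. ?l $ i $ j * v $ i $ j)" for i
  have nn: "0 \<le> ?g $ i * (init D i - (\<Sum>j | j \<noteq> i. v $ i $ j))" "0 \<le> (\<Sum>j | j \<noteq> i. ?l $ i $ j * v $ i $ j)"
    and nnl: "j \<noteq> i \<Longrightarrow> 0 \<le> ?l $ i $ j * v $ i $ j" for i j
    using vf row_dual_nonneg[of D p v] sign_dual_nonneg[of D p v]
    by (auto simp: follower_feasible_def intro!: sum_nonneg mult_nonneg_nonneg)
  have "0 \<le> - (\<Sum>i\<in>UNIV. s i)"
    using follower_first_order[OF assms(1-3) p(2) v \<open>w \<in> follower_feasible D\<close>]
    unfolding row s_def[symmetric] by (simp add: sum_negf)
  moreover have s0: "0 \<le> s i" for i
    using nn[of i] by (simp add: s_def)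
  ultimately have "(\<Sum>i\<in>UNIV. s i) = 0"
    using sum_nonneg[of UNIV s] by simp
  then have "s i = 0" for i
    using s0 by (subst (asm) sum_nonneg_eq_0_iff) auto
  then have zero: "?g $ i * (init D i - (\<Sum>j | j \<noteq> i. v $ i $ j)) = 0
      \<and> (\<Sum>j | j \<noteq> i. ?l $ i $ j * v $ i $ j) = 0" for i
    using nn[of i] unfolding s_def by (subst add_nonneg_eq_0_iff[symmetric]) auto
  have comp: "?g $ i * ((\<Sum>j | j \<noteq> i. v $ i $ j) - init D i) = 0"
      "j \<noteq> i \<Longrightarrow> ?l $ i $ j * v $ i $ j = 0" for i j
  proof -
    fix i j
    have c: "?g $ i * (init D i - (\<Sum>j | j \<noteq> i. v $ i $ j)) = 0"
      "(\<Sum>j | j \<noteq> i. ?l $ i $ j * v $ i $ j) = 0"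
      using zero[of i] by simp_all
    from c(1) show "?g $ i * ((\<Sum>j | j \<noteq> i. v $ i $ j) - init D i) = 0"
      by auto
    from c(2) nnl show "?l $ i $ j * v $ i $ j = 0" if "j \<noteq> i"
      using that by (subst (asm) sum_nonneg_eq_0_iff) auto
  qed
  show ?thesis
    unfolding mpcc_feasible_iff
  proof (intro conjI allI impI)
    show "?l \<in> offdiag" by (simp add: offdiag_def sign_dual_def)
    show "?l $ i $ j = marginal D p v i j + ?g $ i" if "i \<noteq> j" for i j
      using that by (simp add: sign_dual_def)
  qed (use p vf comp row_dual_nonneg sign_dual_nonneg in auto)
qed

lemma kkt_multipliers_unique:
  fixes D :: "('n::finite, 'm::finite) market"
  assumes init: "\<And>i. 0 < init D i" and kkt: "(p, v, l, g) \<in> mpcc_feasible D"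
  shows "l = sign_dual D p v" "g = row_dual D p v"
proof -
  note k = kkt[unfolded mpcc_feasible_iff]
  have "g $ i = row_dual D p v $ i" for i
  proof (rule antisym)
    show "row_dual D p v $ i \<le> g $ i"
    proof (rule row_dual_cases[of D p v i])
      fix j assume "j \<noteq> i" "row_dual D p v $ i = - marginal D p v i j"
      moreover have "0 \<le> l $ i $ j" "l $ i $ j = marginal D p v i j + g $ i"
        using k \<open>j \<noteq> i\<close> by metis+
      ultimately show ?thesis by linarith
    qed (use k in auto)
    show "g $ i \<le> row_dual D p v $ i"
    proof (cases "g $ i = 0")
      case False
      then have "(\<Sum>j | j \<noteq> i. v $ i $ j) \<noteq> 0" using k init[of i] by auto
      then obtain j where j: "j \<noteq> i" "v $ i $ j \<noteq> 0"
        by (metis (mono_tags, lifting) mem_Collect_eq sum.not_neutral_contains_not_neutral)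
      then have "l $ i $ j = 0" "l $ i $ j = marginal D p v i j + g $ i"
        using k j by (metis mult_eq_0_iff, metis)
      then have "g $ i = - marginal D p v i j" by simp
      moreover have "0 \<le> marginal D p v i j + row_dual D p v $ i"
        using sign_dual_nonneg[of D p v i j] j by (simp add: sign_dual_def)
      ultimately show ?thesis by linarith
    qed (simp add: row_dual_nonneg)
  qed
  then show g: "g = row_dual D p v" by (simp add: vec_eq_iff)
  show "l = sign_dual D p v"
  proof -
    have "l $ i $ j = sign_dual D p v $ i $ j" for i j
    proof (cases "j = i")
      case True
      then show ?thesis using k by (simp add: offdiag_def sign_dual_def)
    next
      case False
      then have "l $ i $ j = marginal D p v i j + g $ i" using k by metis
      then show ?thesis using False by (simp add: g sign_dual_def)
    qed
    then show ?thesis by (simp add: vec_eq_iff)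
  qed
qed

text \<open>The MPCC feasible set is a graph over the Wait-and-See feasible set.\<close>

lemma mpcc_feasible_graph:
  fixes D :: "('n::finite, 'm::finite) market"
  assumes "0 < share D" "0 < ybar D" "\<And>k. 0 \<le> scen_prob D k" "\<And>i. 0 < init D i"
    and "\<And>i. 0 \<le> price_min D i"
  shows "(p, v, l, g) \<in> mpcc_feasible D \<longleftrightarrow>
    (p, v) \<in> ws_feasible D \<and> l = sign_dual D p v \<and> g = row_dual D p v"
proof -
  have nn: "0 \<le> p $ i" if "p \<in> price_feasible D" for i
  proof -
    from that have "price_min D i \<le> p $ i" by (simp add: price_feasible_def)
    with assms(5)[of i] show ?thesis by linarith
  qed
  show ?thesis
  proof
    assume kkt: "(p, v, l, g) \<in> mpcc_feasible D"
    then have "p \<in> price_feasible D" by (simp add: mpcc_feasible_iff)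
    then show "(p, v) \<in> ws_feasible D \<and> l = sign_dual D p v \<and> g = row_dual D p v"
      using kkt_sufficient[OF assms(1-3) nn kkt] kkt_multipliers_unique[OF assms(4) kkt]
      by (simp add: ws_feasible_def)
  next
    assume "(p, v) \<in> ws_feasible D \<and> l = sign_dual D p v \<and> g = row_dual D p v"
    then show "(p, v, l, g) \<in> mpcc_feasible D"
      using kkt_necessary[OF assms(1-4) _ nn] by (auto simp: ws_feasible_def)
  qed
qed

section \<open>Bounds on the multipliers\<close>

lemma sum_price_beta_bounds:
  fixes D :: "('n::finite, 'm::finite) market"
  assumes "0 < share D" "share D < 1" "0 < ybar D" "\<And>k. 0 \<le> scen_prob D k"
    "(\<Sum>k\<in>UNIV. scen_prob D k) = 1" "0 \<le> p $ i"
  shows "- p $ i \<le> (\<Sum>k\<in>UNIV. p $ i * beta D p v i k)" "(\<Sum>k\<in>UNIV. p $ i * beta D p v i k) \<le> 0"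
proof -
  have b: "beta D p v i k \<le> 0" "- scen_prob D k \<le> beta D p v i k" for k
  proof -
    define q where "q = max 0 (min 1 ((demand D (scen_demand D k i) i (p $ i) - drivers D v i) / ybar D))"
    have "0 \<le> q" "q \<le> 1" by (auto simp: q_def)
    moreover have "beta D p v i k = - (scen_prob D k * (share D * q))"
      using beta_eq_clamp[OF assms(3), of p v i k] by (simp add: q_def)
    moreover have "share D * q \<le> 1 * 1"
      using assms \<open>0 \<le> q\<close> \<open>q \<le> 1\<close> by (intro mult_mono) auto
    ultimately show "beta D p v i k \<le> 0" "- scen_prob D k \<le> beta D p v i k"
      using assms(1) assms(4)[of k] mult_left_le[of "share D * q" "scen_prob D k"]
      by simp_all
  qed
  show "(\<Sum>k\<in>UNIV. p $ i * beta D p v i k) \<le> 0"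
    using b assms(6) by (intro sum_nonpos mult_nonneg_nonpos) auto
  have "- p $ i = p $ i * (\<Sum>k\<in>UNIV. - scen_prob D k)"
    by (simp add: sum_negf assms(5))
  also have "\<dots> \<le> p $ i * (\<Sum>k\<in>UNIV. beta D p v i k)"
    using b assms(6) by (intro mult_left_mono sum_mono) auto
  finally show "- p $ i \<le> (\<Sum>k\<in>UNIV. p $ i * beta D p v i k)" by (simp add: sum_distrib_left)
qed

text \<open>
  Since the probabilities of the scenarios sum to one, the bounds do not depend on the number of
  scenarios.
\<close>

lemma dual_bounds:
  fixes D :: "('n::finite, 'm::finite) market"
  assumes "0 < share D" "share D < 1" "0 < ybar D" "\<And>k. 0 \<le> scen_prob D k"
    "(\<Sum>k\<in>UNIV. scen_prob D k) = 1"
    and p: "\<And>i. 0 \<le> p $ i" "\<And>i. p $ i \<le> P"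
    and cost: "\<And>i j. i \<noteq> j \<Longrightarrow> 0 \<le> cost D i j"
  shows "row_dual D p v $ i \<le> P" "i \<noteq> j \<Longrightarrow> sign_dual D p v $ i $ j \<le> 2 * P + cost D i j"
proof -
  have m: "- P \<le> marginal D p v i j" "marginal D p v i j \<le> P + cost D i j" if "i \<noteq> j" for i j
  proof -
    define B where "B i = (\<Sum>k\<in>UNIV. p $ i * beta D p v i k)" for i
    have B: "- P \<le> B i" "B i \<le> 0" for i
      using sum_price_beta_bounds[OF assms(1-5) p(1)[of i], of v] p(2)[of i] by (auto simp: B_def)
    have "marginal D p v i j = B j - B i + cost D i j"
      by (simp add: marginal_def sum_subtractf B_def)
    then show "- P \<le> marginal D p v i j" "marginal D p v i j \<le> P + cost D i j"
      using B[of i] B[of j] cost[OF that] by linarith+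
  qed
  show g: "row_dual D p v $ i \<le> P"
  proof (rule row_dual_cases[of D p v i])
    assume "row_dual D p v $ i = 0"
    then show ?thesis using p[of i] by linarith
  next
    fix j assume "j \<noteq> i" "row_dual D p v $ i = - marginal D p v i j"
    then show ?thesis using m(1)[of i j] by auto
  qed
  show "sign_dual D p v $ i $ j \<le> 2 * P + cost D i j" if "i \<noteq> j"
    using m(2)[OF that] g that by (simp add: sign_dual_def)
qed

section \<open>Lifting maximization problems along an embedding\<close>

lemma global_max_on_lift:
  assumes "\<And>z. \<pi> (e z) = z"
  shows "global_max_on f S z \<longleftrightarrow> global_max_on (\<lambda>w. f (\<pi> w)) (e ` S) (e z)"
  using assms unfolding global_max_on_def is_arg_max_def by (metis (no_types, lifting) image_iff)

text \<open>
  Neighbourhoods are pulled back along \<open>\<pi>\<close> in one direction and along the embedding \<open>e\<close> in the other.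
\<close>

lemma local_max_on_lift:
  fixes e :: "'a::topological_space \<Rightarrow> 'b::topological_space"
  assumes inv: "\<And>z. \<pi> (e z) = z"
    and cont: "continuous_on UNIV e" "continuous_on UNIV \<pi>"
  shows "local_max_on f S z \<longleftrightarrow> local_max_on (\<lambda>w. f (\<pi> w)) (e ` S) (e z)"
proof
  assume "local_max_on f S z"
  then obtain U where U: "open U" "z \<in> U" "is_arg_max f (\<lambda>w. w \<in> S \<inter> U) z"
    unfolding local_max_on_def by auto
  have "open (\<pi> -` U)"
    using cont(2) U(1) by (rule open_vimage[rotated])
  with U inv show "local_max_on (\<lambda>w. f (\<pi> w)) (e ` S) (e z)"
    unfolding local_max_on_def by (intro exI[of _ "\<pi> -` U"]) (auto simp: is_arg_max_def)
next
  assume "local_max_on (\<lambda>w. f (\<pi> w)) (e ` S) (e z)"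
  then obtain V where V: "open V" "e z \<in> V" "is_arg_max (\<lambda>w. f (\<pi> w)) (\<lambda>w. w \<in> e ` S \<inter> V) (e z)"
    unfolding local_max_on_def by auto
  have "open (e -` V)"
    using cont(1) V(1) by (rule open_vimage[rotated])
  moreover have "z \<in> S"
    using V(3) inv unfolding is_arg_max_def by (metis Int_iff imageE)
  ultimately show "local_max_on f S z"
    using V inv unfolding local_max_on_def
    by (intro exI[of _ "e -` V"]) (auto simp: is_arg_max_def)
qed

section \<open>Equivalence of the two problems\<close>

theorem proposition4p2:
  fixes D :: "('n::finite, 'm::finite) market" and y d0 :: "real^'n"
  assumes "0 < share D" and "share D < 1"
    and "\<And>i. 0 \<le> price_min D i" and "\<And>i. price_min D i < price_max D i"
    and "\<And>i j. i \<noteq> j \<Longrightarrow> 0 \<le> cost D i j"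
    and "\<And>i. 0 < init D i"
    and "0 < ybar D"
    and "\<And>k. 0 \<le> scen_prob D k" and "(\<Sum>k\<in>UNIV. scen_prob D k) = 1"
  shows "(\<forall>p v. ws_global D y d0 (p, v) \<longleftrightarrow> (\<exists>l g. mpcc_global D y d0 (p, v, l, g)))
    \<and> (\<forall>p v. (p, v) \<in> ws_feasible D \<longrightarrow>
          (ws_local D y d0 (p, v) \<longleftrightarrow>
             (\<forall>l g. (p, v, l, g) \<in> mpcc_feasible D \<longrightarrow> mpcc_local D y d0 (p, v, l, g))))
    \<and> (\<forall>p v l g. (p, v, l, g) \<in> mpcc_feasible D \<longrightarrow>
          (\<forall>i. 0 \<le> g $ i \<and> g $ i \<le> 2 * real CARD('m) * Max (range (price_max D))) \<and>
          (\<forall>i j. i \<noteq> j \<longrightarrow> 0 \<le> l $ i $ j \<and> l $ i $ j \<le> 4 * real CARD('m) * Max (range (price_max D)) + cost D i j))"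
proof -
  \<comment> \<open>The graph embedding of the multiplier map, and the projection that inverts it.\<close>
  define e where "e z = (fst z, snd z, sign_dual D (fst z) (snd z), row_dual D (fst z) (snd z))"
    for z :: "(real^'n) \<times> (real^'n^'n)"
  define \<pi> :: "(real^'n) \<times> (real^'n^'n) \<times> (real^'n^'n) \<times> (real^'n) \<Rightarrow> (real^'n) \<times> (real^'n^'n)"
    where "\<pi> w = (fst w, fst (snd w))" for w
  define f where "f = (\<lambda>(p, v). leader_obj D y d0 p v)"
  note graph = mpcc_feasible_graph[OF assms(1,7,8,6,3)]
  have inv: "\<pi> (e z) = z" for z
    by (simp add: \<pi>_def e_def)
  have T: "mpcc_feasible D = e ` ws_feasible D"
  proof (rule set_eqI)
    fix w :: "(real^'n) \<times> (real^'n^'n) \<times> (real^'n^'n) \<times> (real^'n)"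
    obtain p v l g where w: "w = (p, v, l, g)" by (cases w)
    show "w \<in> mpcc_feasible D \<longleftrightarrow> w \<in> e ` ws_feasible D"
      unfolding w graph by (force simp: e_def image_iff)
  qed
  have F: "(\<lambda>(p, v, l, g). leader_obj D y d0 p v) = (\<lambda>w. f (\<pi> w))"
    by (auto simp: f_def \<pi>_def)
  have cont: "continuous_on UNIV e" "continuous_on UNIV \<pi>"
    unfolding e_def \<pi>_def by (intro continuous_intros continuous_on_duals assms(7))+
  have global_eq: "ws_global D y d0 z \<longleftrightarrow> mpcc_global D y d0 (e z)" for z
    unfolding ws_global_def mpcc_global_def F T f_def[symmetric]
    by (rule global_max_on_lift) (rule inv)
  have local_eq: "ws_local D y d0 z \<longleftrightarrow> mpcc_local D y d0 (e z)" for z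
    unfolding ws_local_def mpcc_local_def F T f_def[symmetric]
    by (rule local_max_on_lift[OF inv cont])
  have feas: "(p, v, l, g) \<in> mpcc_feasible D \<longleftrightarrow> (p, v) \<in> ws_feasible D \<and> (p, v, l, g) = e (p, v)"
    for p v l g
    using graph by (auto simp: e_def)
  have "mpcc_global D y d0 w \<Longrightarrow> w \<in> mpcc_feasible D" for w
    by (simp add: mpcc_global_def global_max_on_def is_arg_max_def)
  then have 1: "ws_global D y d0 (p, v) \<longleftrightarrow> (\<exists>l g. mpcc_global D y d0 (p, v, l, g))" for p v
    using global_eq[of "(p, v)"] feas[of p v] by (metis e_def fst_conv snd_conv)
  have 2: "ws_local D y d0 (p, v) \<longleftrightarrow>
      (\<forall>l g. (p, v, l, g) \<in> mpcc_feasible D \<longrightarrow> mpcc_local D y d0 (p, v, l, g))"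
    if "(p, v) \<in> ws_feasible D" for p v
    using local_eq[of "(p, v)"] feas[of p v] that by (metis e_def fst_conv snd_conv)
  define P where "P = Max (range (price_max D))"
  have 3: "0 \<le> g $ i \<and> g $ i \<le> 2 * real CARD('m) * P"
      "i \<noteq> j \<Longrightarrow> 0 \<le> l $ i $ j \<and> l $ i $ j \<le> 4 * real CARD('m) * P + cost D i j"
    if "(p, v, l, g) \<in> mpcc_feasible D" for p v l g i j
  proof -
    from that have lg: "l = sign_dual D p v" "g = row_dual D p v" and "p \<in> price_feasible D"
      using graph by (auto simp: ws_feasible_def)
    then have p: "price_min D i \<le> p $ i" "p $ i \<le> price_max D i" for i
      by (auto simp: price_feasible_def)
    have p0: "0 \<le> p $ i" for i
      using assms(3)[of i] p(1)[of i] by linarith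
    have pP: "p $ i \<le> P" for i
    proof -
      have "price_max D i \<le> P" unfolding P_def by (intro Max_ge) auto
      with p(2)[of i] show ?thesis by linarith
    qed
    have "0 \<le> P" using p0[of undefined] pP[of undefined] by linarith
    moreover have "1 \<le> real CARD('m)" by (simp add: Suc_leI)
    ultimately have "P \<le> real CARD('m) * P"
      by (simp add: mult_le_cancel_right1)
    note bounds = dual_bounds[OF assms(1,2,7-9) p0 pP assms(5), where v = v and i = i]
    from bounds(1) bounds(2)[of j] \<open>0 \<le> P\<close> \<open>P \<le> real CARD('m) * P\<close>
    show "0 \<le> g $ i \<and> g $ i \<le> 2 * real CARD('m) * P"
      "i \<noteq> j \<Longrightarrow> 0 \<le> l $ i $ j \<and> l $ i $ j \<le> 4 * real CARD('m) * P + cost D i j"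
      unfolding lg using row_dual_nonneg[of D p v i] sign_dual_nonneg[of D p v i j]
      by (force, force)
  qed
  show ?thesis
    using 1 2 3 unfolding P_def by blast
qed

end
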